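(* Let $a,b,r:\mathbb{R}^3\to\mathbb{R}$ and let $$\mathscr{K}u=\frac{\partial}{\partial x}\Big(a\,\frac{\partial u}{\partial x}\Big)+b\,\frac{\partial u}{\partial x}+x\frac{\partial u}{\partial y}-r\,u-\frac{\partial u}{\partial t}.$$ Assume that $a,b,r,\frac{\partial a}{\partial x},\frac{\partial b}{\partial x}\in C^{\alpha}_{\rm loc}(\mathbb{R}^3)$ for some $\alpha\in\,]0,1]$ and that there exist positive constants $\lambda,\Lambda$ such that $\lambda\le a\le\Lambda$ and $|b|,|r|,|\frac{\partial a}{\partial x}|,|\frac{\partial b}{\partial x}|\le\Lambda$ on $\mathbb{R}^3$. Let $t_0<T$, let $\varphi:\mathbb{R}^2\to\mathbb{R}$, and let $u_1,u_2$ be classical solutions to the Cauchy problem $$\begin{cases}\mathscr{K}u=0,&(x,y,t)\in\mathbb{R}^2\times\,]t_0,T],\\ u(x_0,y_0,t_0)=\varphi(x_0,y_0),&(x_0,y_0)\in\mathbb{R}^2.\end{cases}$$ If there exist positive constants $M$ and $C$ such that $$|u_1(x,y,t)|+|u_2(x,y,t)|\le M\exp\big(C(x^2+y^2)\big)\qquad\text{for every }(x,y,t)\in\mathbb{R}^2\times\,]t_0,T],$$ then $u_1=u_2$ in $\mathbb{R}^2\times\,]t_0,T]$.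
   Context: $C^\alpha_{\rm loc}(\mathbb{R}^3)$ is the usual Euclidean space of functions that are Hölder continuous with exponent $\alpha$ on every compact subset of $\mathbb{R}^3$. For $Y=x\partial_y-\partial_t$ the Lie derivative is $Yu(x,y,t):=\lim_{s\to0}\frac{u(x,y+sx,t-s)-u(x,y,t)}{s}$ (one-sided at the final time $t=T$); in $\mathscr{K}u$ the expression $x\partial_yu-\partial_tu$ is understood as $Yu$. A classical solution of $\mathscr{K}u=0$ in a set is a function $u$ such that $\partial_xu$, $\partial_x^2u$ and $Yu$ exist as continuous functions there and the equation holds at every point. The initial condition means that $u(x,y,t)\to\varphi(x_0,y_0)$ as $(x,y,t)\to(x_0,y_0,t_0)$ with $t>t_0$, for every $(x_0,y_0)\in\mathbb{R}^2$. *)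

theory Defs
  imports "HOL-Analysis.Analysis"
begin

text \<open>
  Points \<open>(x, y, t)\<close> of three-dimensional space have type \<open>real \<times> real \<times> real\<close>, whose \<open>dist\<close> is the
  Euclidean distance.
\<close>

type_synonym R3 = "real \<times> real \<times> real"

definition holder_loc :: "real \<Rightarrow> (R3 \<Rightarrow> real) \<Rightarrow> bool" where
  "holder_loc \<alpha> f \<longleftrightarrow>
     (\<forall>K. compact K \<longrightarrow> (\<exists>H. \<forall>p\<in>K. \<forall>q\<in>K. \<bar>f p - f q\<bar> \<le> H * dist p q powr \<alpha>))"

definition dx_exists :: "(R3 \<Rightarrow> real) \<Rightarrow> R3 \<Rightarrow> bool" where
  "dx_exists u = (\<lambda>(x, y, t). (\<lambda>\<xi>. u (\<xi>, y, t)) differentiable (at x))"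

definition dx :: "(R3 \<Rightarrow> real) \<Rightarrow> R3 \<Rightarrow> real" where
  "dx u = (\<lambda>(x, y, t). deriv (\<lambda>\<xi>. u (\<xi>, y, t)) x)"

definition Y_flow :: "real \<Rightarrow> R3 \<Rightarrow> R3" where
  "Y_flow s = (\<lambda>(x, y, t). (x, y + s * x, t - s))"

text \<open>
  The Lie derivative along \<open>Y = x \<partial>\<^sub>y - \<partial>\<^sub>t\<close> of a function living on \<open>S\<close>. Only parameters \<open>s\<close> whose
  flow point stays in \<open>S\<close> are admitted. On the strip below this is the two-sided limit for \<open>t < T\<close>
  and the one-sided limit \<open>s \<rightarrow> 0\<close>, \<open>s > 0\<close>, for \<open>t = T\<close>.
\<close>

definition has_Y_derivative :: "R3 set \<Rightarrow> (R3 \<Rightarrow> real) \<Rightarrow> real \<Rightarrow> R3 \<Rightarrow> bool" where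
  "has_Y_derivative S u l p \<longleftrightarrow>
     ((\<lambda>s. (u (Y_flow s p) - u p) / s) \<longlongrightarrow> l) (at 0 within {s. Y_flow s p \<in> S})"

definition Y_deriv :: "R3 set \<Rightarrow> (R3 \<Rightarrow> real) \<Rightarrow> R3 \<Rightarrow> real" where
  "Y_deriv S u p = (THE l. has_Y_derivative S u l p)"

definition K_op ::
  "(R3 \<Rightarrow> real) \<Rightarrow> (R3 \<Rightarrow> real) \<Rightarrow> (R3 \<Rightarrow> real) \<Rightarrow> R3 set \<Rightarrow> (R3 \<Rightarrow> real) \<Rightarrow> R3 \<Rightarrow> real" where
  "K_op a b r S u p = dx (\<lambda>q. a q * dx u q) p + b p * dx u p + Y_deriv S u p - r p * u p"

definition classical_solution ::
  "(R3 \<Rightarrow> real) \<Rightarrow> (R3 \<Rightarrow> real) \<Rightarrow> (R3 \<Rightarrow> real) \<Rightarrow> R3 set \<Rightarrow> (R3 \<Rightarrow> real) \<Rightarrow> bool" where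
  "classical_solution a b r S u \<longleftrightarrow>
     (\<forall>p\<in>S. dx_exists u p) \<and> continuous_on S (dx u) \<and>
     (\<forall>p\<in>S. dx_exists (dx u) p) \<and> continuous_on S (dx (dx u)) \<and>
     (\<forall>p\<in>S. \<exists>l. has_Y_derivative S u l p) \<and> continuous_on S (Y_deriv S u) \<and>
     (\<forall>p\<in>S. K_op a b r S u p = 0)"

definition strip :: "real \<Rightarrow> real \<Rightarrow> R3 set" where
  "strip t0 T = UNIV \<times> UNIV \<times> {t0<..T}"

text \<open>
  The values of \<open>u\<close> outside the strip, in particular at \<open>t = t0\<close>, play no role: the initial datum is
  attained as a limit from inside the strip.
\<close>

definition cauchy_solution ::
  "(R3 \<Rightarrow> real) \<Rightarrow> (R3 \<Rightarrow> real) \<Rightarrow> (R3 \<Rightarrow> real) \<Rightarrow> real \<Rightarrow> real \<Rightarrow> (real \<times> real \<Rightarrow> real)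
     \<Rightarrow> (R3 \<Rightarrow> real) \<Rightarrow> bool" where
  "cauchy_solution a b r t0 T \<phi> u \<longleftrightarrow>
     classical_solution a b r (strip t0 T) u \<and>
     (\<forall>x0 y0. (u \<longlongrightarrow> \<phi> (x0, y0)) (at (x0, y0, t0) within strip t0 T))"

end

theory Submission
  imports Defs
begin

text \<open>
  On a short time interval starting at \<open>t\<^sub>1\<close> the function
  \<open>H = exp (k(t) (x\<^sup>2 + y\<^sup>2) + D (t - t\<^sub>1))\<close>, with \<open>k\<close> affine, \<open>k(t\<^sub>1) = C + 1\<close> and \<open>k'\<close> and \<open>D\<close> large,
  satisfies \<open>\<K>H < 0\<close>. If \<open>w = u\<^sub>1 - u\<^sub>2\<close> vanishes at time \<open>t\<^sub>1\<close> and is positive somewhere, then \<open>w / H\<close>,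
  which decays at infinity, attains a maximum \<open>m > 0\<close>. There \<open>w - m H\<close> has a maximum with value \<open>0\<close>, so
  its \<open>x\<close>-derivative vanishes and its second \<open>x\<close>-derivative and \<open>Y\<close>-derivative are nonpositive. Hence
  \<open>0 \<ge> \<K>(w - m H) = - m \<K>H > 0\<close>, a contradiction. Finitely many intervals of the same length cover
  the strip.
\<close>

section \<open>Calculus in \<open>x\<close> and along the flow\<close>

lemma dx_has_real_derivative:
  assumes "dx_exists u (x, y, t)"
  shows "((\<lambda>\<xi>. u (\<xi>, y, t)) has_real_derivative dx u (x, y, t)) (at x)"
  using assms by (simp add: dx_exists_def dx_def DERIV_deriv_iff_real_differentiable)

text \<open>The product rule in \<open>x\<close> gives this nondivergence form, in which the sign
  conditions at a maximum can be inserted term by term.\<close>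

lemma K_op_expand:
  assumes "dx_exists a p" and "dx_exists (dx u) p"
  shows "K_op a b r S u p =
    a p * dx (dx u) p + (dx a p + b p) * dx u p + Y_deriv S u p - r p * u p"
proof -
  obtain x y t where p: "p = (x, y, t)" by (cases p) auto
  have "((\<lambda>\<xi>. a (\<xi>, y, t) * dx u (\<xi>, y, t)) has_real_derivative
      dx a p * dx u p + dx (dx u) p * a p) (at x)"
    unfolding p by (intro DERIV_mult dx_has_real_derivative assms[unfolded p])
  then have "dx (\<lambda>q. a q * dx u q) p = dx a p * dx u p + dx (dx u) p * a p"
    unfolding p dx_def[of "\<lambda>q. a q * dx u q"] by (simp add: DERIV_imp_deriv)
  then show ?thesis by (simp add: K_op_def algebra_simps)
qed

lemma Y_flow_in_strip [simp]:
  "Y_flow s (x, y, t) \<in> strip t0 T \<longleftrightarrow> t0 < t - s \<and> t - s \<le> T"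
  by (auto simp: Y_flow_def strip_def)

text \<open>A small positive \<open>s\<close> moves backward in time and stays in the strip even
  when \<open>t = T\<close>. Limits along this filter are therefore unique, which makes the
  \<open>THE\<close> in \<open>Y_deriv\<close> meaningful on the strip.\<close>

lemma at_within_strip_nontrivial:
  assumes "p \<in> strip t0 T"
  shows "at 0 within {s. Y_flow s p \<in> strip t0 T} \<noteq> bot"
proof -
  obtain x y t where p: "p = (x, y, t)" by (cases p) auto
  with assms have t: "t0 < t" "t \<le> T" by (auto simp: strip_def)
  have "at (0::real) within {0<..<t - t0} \<noteq> bot"
    using t by (simp add: trivial_limit_within islimpt_greaterThanLessThan1)
  moreover have "at 0 within {0<..<t - t0} \<le> at 0 within {s. Y_flow s p \<in> strip t0 T}"
    using t by (intro at_le) (auto simp: p)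
  ultimately show ?thesis using bot.extremum_unique by metis
qed

lemma has_Y_derivative_Y_deriv:
  assumes "p \<in> strip t0 T" and "\<exists>l. has_Y_derivative (strip t0 T) u l p"
  shows "has_Y_derivative (strip t0 T) u (Y_deriv (strip t0 T) u p) p"
proof -
  from assms obtain l where l: "has_Y_derivative (strip t0 T) u l p" by auto
  have "Y_deriv (strip t0 T) u p = l"
    unfolding Y_deriv_def
    using l tendsto_unique[OF at_within_strip_nontrivial[OF assms(1)]]
    unfolding has_Y_derivative_def by blast
  with l show ?thesis by simp
qed

text \<open>By the group law of the flow, a difference quotient based at a later point of an orbit
  is one along the same orbit. This makes one-variable calculus available on orbits, with a
  one-sided \<open>I\<close> where the final time requires it.\<close>

lemma has_Y_derivative_along_flow:
  assumes "has_Y_derivative S u l (Y_flow s p)" and "\<And>s'. s' \<in> I \<Longrightarrow> Y_flow s' p \<in> S"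
  shows "((\<lambda>s. u (Y_flow s p)) has_real_derivative l) (at s within I)"
proof -
  have flow: "Y_flow h (Y_flow s p) = Y_flow (s + h) p" for h
    by (cases p) (auto simp: Y_flow_def algebra_simps)
  have "((\<lambda>h. (u (Y_flow (s + h) p) - u (Y_flow s p)) / h) \<longlongrightarrow> l)
      (at 0 within {h. Y_flow (s + h) p \<in> S})"
    using assms(1) by (simp add: has_Y_derivative_def flow)
  then have "((\<lambda>s'. (u (Y_flow (s + (s' - s)) p) - u (Y_flow s p)) / (s' - s)) \<longlongrightarrow> l) (at s within I)"
    by (rule filterlim_compose)
      (auto simp: filterlim_at eventually_at_filter assms(2) intro!: tendsto_eq_intros)
  then show ?thesis by (simp add: has_field_derivative_iff)
qed

text \<open>If \<open>l\<close> were positive, \<open>h'\<close> would be positive just to the right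
  of its zero \<open>x\<close>, and the mean value theorem would lift \<open>h\<close> above its
  maximum.\<close>

lemma real_maximum_second_derivative:
  fixes h h' :: "real \<Rightarrow> real"
  assumes h: "\<And>\<xi>. (h has_real_derivative h' \<xi>) (at \<xi>)"
    and h': "(h' has_real_derivative l) (at x)"
    and max: "\<And>\<xi>. h \<xi> \<le> h x"
  shows "h' x = 0" and "l \<le> 0"
proof -
  show zero: "h' x = 0"
    using DERIV_local_max[OF h, of 1] max by auto
  show "l \<le> 0"
  proof (rule ccontr)
    assume "\<not> l \<le> 0"
    then obtain d where d: "0 < d" "\<And>e. 0 < e \<Longrightarrow> e < d \<Longrightarrow> h' x < h' (x + e)"
      using DERIV_pos_inc_right[OF h'] by auto
    have "x < x + d / 2" using d by simp
    from MVT2[OF this h] obtain z where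
      z: "x < z" "z < x + d / 2" "h (x + d / 2) - h x = (x + d / 2 - x) * h' z" by blast
    have "0 < h' z" using d(2)[of "z - x"] z d(1) zero by simp
    then have "h x < h (x + d / 2)" using z d(1) by (smt (verit) mult_pos_pos)
    with max show False by (meson leD)
  qed
qed

section \<open>Continuity of classical solutions\<close>

text \<open>
  Continuity is assumed of \<open>\<partial>\<^sub>x u\<close>, \<open>\<partial>\<^sub>x\<^sup>2 u\<close> and \<open>Yu\<close> but not of \<open>u\<close>. Two nearby points are joined by two \<open>x\<close>-segments and
  two backward \<open>Y\<close>-flow lines, the \<open>x\<close>-coordinate \<open>\<xi>\<close> of the second flow line being chosen to correct
  the \<open>y\<close>-coordinate; running backward keeps the path below the final time \<open>T\<close>.
\<close>

lemma classical_solution_continuous_on: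
  assumes "classical_solution a b r (strip t0 T) u"
  shows "continuous_on (strip t0 T) u"
  unfolding continuous_on_eq_continuous_within
proof
  fix p assume p: "p \<in> strip t0 T"
  obtain x0 y0 \<tau> where pxy: "p = (x0, y0, \<tau>)" by (cases p) auto
  have \<tau>: "t0 < \<tau>" "\<tau> \<le> T" using p by (auto simp: pxy strip_def)
  let ?S = "strip t0 T"
  \<comment> \<open>The box \<open>N\<close> has to contain the whole path. On it \<open>y\<close>
    starts within 1 of \<open>y0\<close> and then drifts for a time at most 2 at speed at most
    \<open>\<bar>x0\<bar> + 1\<close>. The lower time bound keeps \<open>N\<close> away from
    \<open>t0\<close>, so that it is a compact subset of the strip.\<close>
  define R where "R = 1 + 2 * (\<bar>x0\<bar> + 1)"
  define N where "N = {x0 - 1..x0 + 1} \<times> {y0 - R..y0 + R} \<times> {(t0 + \<tau>) / 2..T}"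
  have NS: "N \<subseteq> ?S" using \<tau> by (auto simp: N_def strip_def)
  have comp: "compact N" unfolding N_def by (intro compact_Times compact_Icc)
  have "bounded (dx u ` N)" "bounded (Y_deriv ?S u ` N)"
    using assms NS by (auto simp: classical_solution_def
        intro!: compact_imp_bounded compact_continuous_image comp intro: continuous_on_subset)
  then obtain L1 L2 where L1: "\<And>q. q \<in> N \<Longrightarrow> \<bar>dx u q\<bar> \<le> L1"
    and L2: "\<And>q. q \<in> N \<Longrightarrow> \<bar>Y_deriv ?S u q\<bar> \<le> L2"
    unfolding bounded_iff by (metis image_eqI real_norm_def)
  define L where "L = \<bar>L1\<bar> + \<bar>L2\<bar> + 1"
  have L: "L > 0" "\<And>q. q \<in> N \<Longrightarrow> \<bar>dx u q\<bar> \<le> L" "\<And>q. q \<in> N \<Longrightarrow> \<bar>Y_deriv ?S u q\<bar> \<le> L"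
    unfolding L_def using L1 L2 by force+
  have xlip: "\<bar>u (\<xi>, y, t) - u (\<eta>, y, t)\<bar> \<le> L * \<bar>\<xi> - \<eta>\<bar>"
    if "(\<xi>, y, t) \<in> N" "(\<eta>, y, t) \<in> N" for \<xi> \<eta> y t
  proof -
    have *: "(z, y, t) \<in> N" if "z \<in> {x0 - 1..x0 + 1}" for z
      using that \<open>(\<xi>, y, t) \<in> N\<close> by (auto simp: N_def)
    have "norm (u (\<xi>, y, t) - u (\<eta>, y, t)) \<le> L * norm (\<xi> - \<eta>)"
    proof (rule field_differentiable_bound[where S = "{x0 - 1..x0 + 1}" and f' = "\<lambda>z. dx u (z, y, t)"])
      show "((\<lambda>z. u (z, y, t)) has_field_derivative dx u (z, y, t)) (at z within {x0 - 1..x0 + 1})"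
        if "z \<in> {x0 - 1..x0 + 1}" for z
        using *[OF that] NS assms
        by (intro DERIV_subset[OF dx_has_real_derivative]) (auto simp: classical_solution_def)
    qed (use * L that in \<open>auto simp: N_def\<close>)
    then show ?thesis by simp
  qed
  have Ylip: "\<bar>u (Y_flow s q) - u q\<bar> \<le> L * s"
    if s: "0 \<le> s" and q: "\<And>s'. 0 \<le> s' \<Longrightarrow> s' \<le> s \<Longrightarrow> Y_flow s' q \<in> N" for s q
  proof -
    have "norm (u (Y_flow s q) - u (Y_flow 0 q)) \<le> L * norm (s - 0)"
    proof (rule field_differentiable_bound[where S = "{0..s}" and f' = "\<lambda>s. Y_deriv ?S u (Y_flow s q)"])
      show "((\<lambda>s. u (Y_flow s q)) has_field_derivative Y_deriv ?S u (Y_flow z q)) (at z within {0..s})"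
        if "z \<in> {0..s}" for z
      proof (rule has_Y_derivative_along_flow[where S = ?S])
        have "Y_flow z q \<in> ?S" using q[of z] that NS by auto
        then show "has_Y_derivative ?S u (Y_deriv ?S u (Y_flow z q)) (Y_flow z q)"
          using assms by (intro has_Y_derivative_Y_deriv) (auto simp: classical_solution_def)
        show "Y_flow s' q \<in> ?S" if "s' \<in> {0..s}" for s'
          using q[of s'] that NS by auto
      qed
    qed (use L q s in auto)
    moreover have "Y_flow 0 q = q" by (cases q) (simp add: Y_flow_def)
    ultimately show ?thesis using s by simp
  qed
  show "continuous (at p within ?S) u"
    unfolding continuous_within tendsto_iff
  proof (intro allI impI)
    fix e :: real assume e: "e > 0"
    \<comment> \<open>The second bound keeps the lowest time \<open>\<tau> - \<epsilon>\<close>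
      inside \<open>N\<close>. The third serves the final estimate: the four legs of the path
      contribute at most \<open>(2 + 2 + 1 + 1) * L * \<epsilon>\<close>, which is then below
      \<open>e\<close>.\<close>
    define \<epsilon> where "\<epsilon> = min 1 (min ((\<tau> - t0) / 2) (e / (7 * L)))"
    have \<epsilon>: "0 < \<epsilon>" "\<epsilon> \<le> 1" "\<epsilon> \<le> (\<tau> - t0) / 2" "\<epsilon> \<le> e / (7 * L)"
      using \<tau> e L(1) unfolding \<epsilon>_def
      by (simp_all only: min_less_iff_conj min.coboundedI1 min.coboundedI2 order_refl) auto
    have Le: "6 * L * \<epsilon> < e"
    proof -
      have "7 * L * \<epsilon> \<le> e" using \<epsilon>(4) L(1) by (simp add: field_simps)
      moreover have "0 < L * \<epsilon>" using \<epsilon> L by simp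
      ultimately show ?thesis by simp
    qed
    \<comment> \<open>This solves \<open>y + s * \<xi> = y0 + \<epsilon> * x0\<close> with
      \<open>s = \<epsilon> + (t - \<tau>)\<close>: the flow lines from \<open>(\<xi>, y, t)\<close>
      for time \<open>s\<close> and from \<open>p\<close> for time \<open>\<epsilon>\<close> end at
      the same \<open>y\<close> and the same time. Near \<open>p\<close> the denominator is close to
      \<epsilon> > 0, so \<xi> tends to \<open>x0\<close>.\<close>
    define \<xi> where "\<xi> = (\<lambda>(x::real, y, t). x0 + (y0 - y - (t - \<tau>) * x0) / (\<epsilon> + (t - \<tau>)))"
    have fst_lim: "(fst \<longlongrightarrow> x0) (at p within ?S)"
      and y_lim: "((\<lambda>q. fst (snd q)) \<longlongrightarrow> y0) (at p within ?S)"
      and t_lim: "((\<lambda>q. snd (snd q)) \<longlongrightarrow> \<tau>) (at p within ?S)"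
      by (auto simp: pxy intro!: tendsto_eq_intros)
    have \<xi>_lim: "(\<xi> \<longlongrightarrow> x0) (at p within ?S)"
      unfolding \<xi>_def case_prod_beta using \<epsilon>(1)
      by (auto intro!: tendsto_eq_intros y_lim t_lim simp: pxy)
    have "\<forall>\<^sub>F q in at p within ?S. dist (fst q) x0 < \<epsilon>"
      "\<forall>\<^sub>F q in at p within ?S. dist (fst (snd q)) y0 < 1"
      "\<forall>\<^sub>F q in at p within ?S. dist (snd (snd q)) \<tau> < \<epsilon>"
      "\<forall>\<^sub>F q in at p within ?S. dist (\<xi> q) x0 < \<epsilon>"
      using \<epsilon>(1) by (intro tendstoD fst_lim y_lim t_lim \<xi>_lim; simp)+
    moreover have "\<forall>\<^sub>F q in at p within ?S. q \<in> ?S"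
      by (simp add: eventually_at_filter)
    ultimately show "\<forall>\<^sub>F q in at p within ?S. dist (u q) (u p) < e"
    proof eventually_elim
      case (elim q)
      obtain x y t where q: "q = (x, y, t)" by (cases q) auto
      define X where "X = \<xi> q"
      define s where "s = \<epsilon> + (t - \<tau>)"
      have b: "\<bar>x - x0\<bar> < \<epsilon>" "\<bar>y - y0\<bar> < 1" "\<bar>t - \<tau>\<bar> < \<epsilon>" "\<bar>X - x0\<bar> < \<epsilon>" "t \<le> T"
        using elim by (auto simp: q dist_real_def X_def strip_def)
      have s: "0 < s" "s < 2 * \<epsilon>" using b by (auto simp: s_def)
      have meet: "y + s * X = y0 + \<epsilon> * x0"
        using s(1) unfolding X_def \<xi>_def q s_def by (simp add: field_simps)
      have drift: "\<bar>s' * z\<bar> \<le> 2 * (\<bar>x0\<bar> + 1)"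
        if "0 \<le> s'" "s' \<le> 2 * \<epsilon>" "\<bar>z - x0\<bar> < \<epsilon>" for s' z
        unfolding abs_mult using that \<epsilon> by (intro mult_mono) auto
      have f1: "Y_flow s' (X, y, t) \<in> N" if "0 \<le> s'" "s' \<le> s" for s'
        using drift[of s' X] that s b \<epsilon> unfolding N_def R_def Y_flow_def s_def
        by (auto simp: abs_le_iff field_simps abs_less_iff)
      have f2: "Y_flow s' (x0, y0, \<tau>) \<in> N" if "0 \<le> s'" "s' \<le> \<epsilon>" for s'
        using drift[of s' x0] that b \<epsilon> \<tau> unfolding N_def R_def Y_flow_def
        by (auto simp: abs_le_iff field_simps)
      have n1: "(x, y, t) \<in> N"
        using f1[of 0] s b \<epsilon> by (auto simp: N_def Y_flow_def abs_less_iff)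
      have n2: "(X, y, t) \<in> N" using f1[of 0] s by (simp add: Y_flow_def)
      have e1: "Y_flow s (X, y, t) = (X, y0 + \<epsilon> * x0, \<tau> - \<epsilon>)"
        using meet by (simp add: Y_flow_def s_def)
      have e2: "Y_flow \<epsilon> (x0, y0, \<tau>) = (x0, y0 + \<epsilon> * x0, \<tau> - \<epsilon>)"
        by (simp add: Y_flow_def)
      have "\<bar>u (x, y, t) - u (X, y, t)\<bar> \<le> L * \<bar>x - X\<bar>" using xlip n1 n2 .
      moreover have "L * \<bar>x - X\<bar> \<le> L * (2 * \<epsilon>)" using b L(1) by (intro mult_left_mono) auto
      moreover have "\<bar>u (X, y0 + \<epsilon> * x0, \<tau> - \<epsilon>) - u (X, y, t)\<bar> \<le> L * s"
        using Ylip[of s "(X, y, t)"] f1 s e1 by simp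
      moreover have "L * s \<le> L * (2 * \<epsilon>)" using s L(1) by (intro mult_left_mono) auto
      moreover have "\<bar>u (X, y0 + \<epsilon> * x0, \<tau> - \<epsilon>) - u (x0, y0 + \<epsilon> * x0, \<tau> - \<epsilon>)\<bar> \<le> L * \<bar>X - x0\<bar>"
        using xlip f1[of s] f2[of \<epsilon>] s \<epsilon> e1 e2 by simp
      moreover have "L * \<bar>X - x0\<bar> \<le> L * \<epsilon>" using b L(1) by (intro mult_left_mono) auto
      moreover have "\<bar>u (x0, y0 + \<epsilon> * x0, \<tau> - \<epsilon>) - u (x0, y0, \<tau>)\<bar> \<le> L * \<epsilon>"
        using Ylip[of \<epsilon> "(x0, y0, \<tau>)"] f2 \<epsilon> e2 by simp
      ultimately have "\<bar>u q - u p\<bar> \<le> 6 * (L * \<epsilon>)" unfolding q pxy by linarith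
      then show ?case using Le by (simp add: dist_real_def)
    qed
  qed
qed

section \<open>The Gaussian barrier\<close>

definition barrier :: "real \<Rightarrow> real \<Rightarrow> real \<Rightarrow> real \<Rightarrow> R3 \<Rightarrow> real" where
  "barrier A \<beta> D t1 = (\<lambda>(x, y, t). exp ((A + \<beta> * (t - t1)) * (x\<^sup>2 + y\<^sup>2) + D * (t - t1)))"

lemma barrier_pos: "0 < barrier A \<beta> D t1 p"
  by (cases p) (simp add: barrier_def)

lemma continuous_on_barrier: "continuous_on S (barrier A \<beta> D t1)"
  unfolding barrier_def case_prod_beta by (intro continuous_intros)

lemma barrier_dx:
  "((\<lambda>\<xi>. barrier A \<beta> D t1 (\<xi>, y, t)) has_real_derivative
     barrier A \<beta> D t1 (x, y, t) * (2 * (A + \<beta> * (t - t1)) * x)) (at x)"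
  unfolding barrier_def by (auto intro!: derivative_eq_intros)

lemma barrier_dxx:
  fixes A \<beta> t t1 :: real
  defines "k \<equiv> A + \<beta> * (t - t1)"
  shows "((\<lambda>\<xi>. barrier A \<beta> D t1 (\<xi>, y, t) * (2 * k * \<xi>)) has_real_derivative
     barrier A \<beta> D t1 (x, y, t) * (2 * k + 4 * k\<^sup>2 * x\<^sup>2)) (at x)"
  unfolding k_def
  by (auto intro!: derivative_eq_intros barrier_dx simp: algebra_simps power2_eq_square)

text \<open>The cross term is the transport in \<open>y\<close>; the two subtracted terms come from
  running time backward, and they are the ones that will dominate the rest of the operator.\<close>

lemma barrier_Y:
  "((\<lambda>s. barrier A \<beta> D t1 (Y_flow s (x, y, t))) has_real_derivative
     barrier A \<beta> D t1 (x, y, t) *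
       (2 * (A + \<beta> * (t - t1)) * x * y - \<beta> * (x\<^sup>2 + y\<^sup>2) - D)) (at 0)"
  unfolding barrier_def Y_flow_def
  by (auto intro!: derivative_eq_intros simp: algebra_simps power2_eq_square)

text \<open>The left-hand side is \<open>\<K>H / H\<close> for the barrier \<open>H\<close>, at a time where the coefficient of \<open>x\<^sup>2 + y\<^sup>2\<close> is \<open>k\<close>.\<close>

lemma barrier_supersolution:
  fixes k K Lam :: real
  defines "\<beta> \<equiv> 4 * Lam * K\<^sup>2 + 2 * Lam * K + K" and "D \<equiv> 4 * Lam * K + Lam + 1"
  assumes k: "0 \<le> k" "k \<le> K" and a: "0 \<le> a" "a \<le> Lam"
    and "\<bar>a'\<bar> \<le> Lam" "\<bar>b\<bar> \<le> Lam" "\<bar>r\<bar> \<le> Lam"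
  shows "a * (2 * k + 4 * k\<^sup>2 * x\<^sup>2) + (a' + b) * (2 * k * x)
      + (2 * k * x * y - \<beta> * (x\<^sup>2 + y\<^sup>2) - D) - r < 0"
proof -
  have Lam: "0 \<le> Lam" using a by simp
  have "a * (2 * k + 4 * k\<^sup>2 * x\<^sup>2) \<le> Lam * (2 * K + 4 * K\<^sup>2 * x\<^sup>2)"
  proof -
    have "k\<^sup>2 * x\<^sup>2 \<le> K\<^sup>2 * x\<^sup>2" using k by (intro mult_right_mono power_mono) auto
    then show ?thesis using k a by (intro mult_mono) auto
  qed
  moreover have "(a' + b) * (2 * k * x) \<le> 2 * Lam * (K * (1 + x\<^sup>2))"
  proof -
    have "2 * \<bar>x\<bar> \<le> 1 + x\<^sup>2" using sum_squares_bound[of 1 "\<bar>x\<bar>"] by simp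
    then have "k * (2 * \<bar>x\<bar>) \<le> K * (1 + x\<^sup>2)" using k by (intro mult_mono) auto
    then have "\<bar>a' + b\<bar> * (k * (2 * \<bar>x\<bar>)) \<le> 2 * Lam * (K * (1 + x\<^sup>2))"
      using \<open>\<bar>a'\<bar> \<le> Lam\<close> \<open>\<bar>b\<bar> \<le> Lam\<close> k Lam by (intro mult_mono[where a = "\<bar>a' + b\<bar>"]) auto
    moreover have "\<bar>(a' + b) * (2 * k * x)\<bar> = \<bar>a' + b\<bar> * (k * (2 * \<bar>x\<bar>))"
      using k by (simp add: abs_mult)
    ultimately show ?thesis by linarith
  qed
  moreover have "2 * k * x * y \<le> K * (x\<^sup>2 + y\<^sup>2)"
  proof -
    have "k * (2 * x * y) \<le> k * (x\<^sup>2 + y\<^sup>2)"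
      using k sum_squares_bound[of x y] by (intro mult_left_mono) auto
    also have "\<dots> \<le> K * (x\<^sup>2 + y\<^sup>2)" using k by (intro mult_right_mono) auto
    finally show ?thesis by (simp add: mult_ac)
  qed
  \<comment> \<open>The choice of \<beta> matches the \<open>x\<^sup>2\<close> coefficient exactly
    and leaves a surplus in \<open>y\<^sup>2\<close>. In \<open>D\<close>, the part
    \<open>4 * Lam * K\<close> pays for the constants, \<open>Lam\<close> for \<open>r\<close>, and
    the final 1 makes the inequality strict.\<close>
  moreover have "Lam * (2 * K + 4 * K\<^sup>2 * x\<^sup>2) + 2 * Lam * (K * (1 + x\<^sup>2)) + K * (x\<^sup>2 + y\<^sup>2)
      = \<beta> * (x\<^sup>2 + y\<^sup>2) + D - Lam - 1 - Lam * (4 * K\<^sup>2 + 2 * K) * y\<^sup>2"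
    unfolding \<beta>_def D_def by (simp add: algebra_simps)
  moreover have "0 \<le> Lam * (4 * K\<^sup>2 + 2 * K) * y\<^sup>2" using Lam k by auto
  ultimately show ?thesis using \<open>\<bar>r\<bar> \<le> Lam\<close> by linarith
qed

section \<open>Comparison on a short time interval\<close>

text \<open>During time \<open>1 / \<beta>\<close> the coefficient of
  \<open>x\<^sup>2 + y\<^sup>2\<close> rises only from \<open>C + 1\<close> to
  \<open>K = C + 2\<close>, so the barrier estimate applies throughout. Since \<beta> depends on
  \<open>Lam\<close> and \<open>C\<close> alone, the step can be repeated from any \<open>t1\<close>
  with the same length.\<close>

lemma cauchy_comparison_step:
  fixes Lam C :: real
  defines "K \<equiv> C + 2"
  defines "\<beta> \<equiv> 4 * Lam * K\<^sup>2 + 2 * Lam * K + K"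
  assumes da: "\<And>p. dx_exists a p"
    and a0: "\<And>p. 0 \<le> a p" and aL: "\<And>p. a p \<le> Lam" and b: "\<And>p. \<bar>b p\<bar> \<le> Lam"
    and r: "\<And>p. \<bar>r p\<bar> \<le> Lam" and a': "\<And>p. \<bar>dx a p\<bar> \<le> Lam"
    and t1: "t0 \<le> t1"
    and u: "classical_solution a b r (strip t0 T) u"
    and v: "classical_solution a b r (strip t0 T) v"
    and M: "0 < M" and C: "0 < C"
    and growth: "\<And>x y t. (x, y, t) \<in> strip t0 T \<Longrightarrow>
      u (x, y, t) - v (x, y, t) \<le> M * exp (C * (x\<^sup>2 + y\<^sup>2))"
    and init: "\<And>x y. ((\<lambda>q. u q - v q) \<longlongrightarrow> 0) (at (x, y, t1) within strip t1 T)"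
    and t: "t1 < t" "t \<le> T" "t \<le> t1 + 1 / \<beta>"
  shows "u (x, y, t) \<le> v (x, y, t)"
proof (rule ccontr)
  assume neg: "\<not> ?thesis"
  let ?S = "strip t0 T"
  define D where "D = 4 * Lam * K + Lam + 1"
  define A where "A = C + 1"
  define w where "w = (\<lambda>q. u q - v q)"
  define H where "H = barrier A \<beta> D t1"
  define T' where "T' = min T (t1 + 1 / \<beta>)"
  have Lam: "0 \<le> Lam" using a0 aL order_trans by blast
  have K: "0 < K" using C by (simp add: K_def)
  have \<beta>: "0 < \<beta>" unfolding \<beta>_def using Lam K by (intro add_nonneg_pos) auto
  have D: "0 \<le> D" unfolding D_def using Lam K by auto
  have H_pos: "0 < H q" for q by (simp add: H_def barrier_pos)
  have H_ge: "exp (A * (x\<^sup>2 + y\<^sup>2)) \<le> H (x, y, t)" if "t1 \<le> t" for x y t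
  proof -
    have "0 \<le> \<beta> * (t - t1) * (x\<^sup>2 + y\<^sup>2)" "0 \<le> D * (t - t1)" using that \<beta> D by auto
    then show ?thesis by (simp add: H_def barrier_def algebra_simps)
  qed
  define f where "f = (\<lambda>q. w q / H q)"
  define c where "c = f (x, y, t)"
  have c: "0 < c" using neg H_pos by (simp add: c_def f_def w_def)
  \<comment> \<open>The excess of \<open>A = C + 1\<close> over the growth rate \<open>C\<close> is
    what yields Gaussian decay.\<close>
  have f_le: "f (x, y, t) \<le> M * exp (- (x\<^sup>2 + y\<^sup>2))" if "t1 < t" "t \<le> T" for x y t
  proof -
    have "w (x, y, t) \<le> M * exp (- (x\<^sup>2 + y\<^sup>2)) * exp (A * (x\<^sup>2 + y\<^sup>2))"
      using growth[of x y t] that t1 by (simp add: w_def A_def strip_def algebra_simps flip: exp_add)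
    also have "\<dots> \<le> M * exp (- (x\<^sup>2 + y\<^sup>2)) * H (x, y, t)"
      using M H_ge that by (intro mult_left_mono) auto
    finally show ?thesis using H_pos by (simp add: f_def divide_le_eq)
  qed
  \<comment> \<open>Outside the box \<open>x\<^sup>2 + y\<^sup>2 \<ge> R > M / c\<close> (using
    \<open>R \<ge> 1\<close>), so the decay forces \<open>f\<close> below its value \<open>c\<close>
    at the given point, which itself lies in the box.\<close>
  define R where "R = max (M / c) (max \<bar>x\<bar> \<bar>y\<bar>) + 1"
  have R: "M / c < R" "\<bar>x\<bar> \<le> R" "\<bar>y\<bar> \<le> R" "1 \<le> R" using M c by (auto simp: R_def)
  have far: "f (x, y, t) < c" if "t1 < t" "t \<le> T" "\<bar>x\<bar> > R \<or> \<bar>y\<bar> > R" for x y t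
  proof -
    have "R \<le> x\<^sup>2 + y\<^sup>2"
    proof -
      have "z\<^sup>2 \<ge> R" if "\<bar>z\<bar> > R" for z
      proof -
        have "R * 1 \<le> \<bar>z\<bar> * \<bar>z\<bar>" using that R(4) by (intro mult_mono) auto
        then show ?thesis by (simp add: power2_eq_square)
      qed
      then show ?thesis using that(3) by (smt (verit) zero_le_power2)
    qed
    also have "\<dots> < exp (x\<^sup>2 + y\<^sup>2)" using exp_ge_add_one_self[of "x\<^sup>2 + y\<^sup>2"] by linarith
    finally have "M / c < exp (x\<^sup>2 + y\<^sup>2)" using R(1) by linarith
    then have "M * exp (- (x\<^sup>2 + y\<^sup>2)) < c" using c unfolding exp_minus by (simp add: field_simps)
    with f_le[OF that(1,2), of x y] show ?thesis by linarith
  qed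
  define B where "B = {-R..R} \<times> {-R..R} \<times> {t1..T'}"
  \<comment> \<open>The value of \<open>f\<close> at time \<open>t1\<close> need not be the limit
    from later times. Replacing it by that limit, 0, gives a continuous function on the closed
    box.\<close>
  define F where "F = (\<lambda>q. if snd (snd q) \<le> t1 then 0 else f q)"
  have w_cont: "continuous_on ?S w"
    unfolding w_def using u v by (intro continuous_intros classical_solution_continuous_on)
  have F_cont: "continuous_on B F"
    unfolding continuous_on_eq_continuous_within
  proof
    fix q assume q: "q \<in> B"
    obtain x y s where qxy: "q = (x, y, s)" by (cases q) auto
    have s: "t1 \<le> s" "s \<le> T'" using q by (auto simp: qxy B_def)
    have H_lim: "(H \<longlongrightarrow> H q) (at q within V)" for V
      using continuous_on_barrier[of UNIV A \<beta> D t1]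
      unfolding H_def continuous_on_def by (blast intro: tendsto_within_subset)
    show "continuous (at q within B) F"
    proof (cases "s = t1")
      case True
      \<comment> \<open>At the initial time \<open>B\<close> is covered by the open-bottom strip,
        where the initial limit applies, and the set of times up to \<open>t1\<close>, where
        \<open>F\<close> is identically 0.\<close>
      have "(f \<longlongrightarrow> 0 / H q) (at q within strip t1 T)"
        unfolding f_def using H_pos[of q] init[of x y] H_lim
        by (intro tendsto_divide) (auto simp: w_def qxy True)
      then have "(f \<longlongrightarrow> 0) (at q within strip t1 T)" by simp
      then have "(F \<longlongrightarrow> 0) (at q within strip t1 T)"
        by (rule Lim_transform_eventually) (auto simp: eventually_at_filter F_def strip_def intro!: always_eventually)
      moreover have "(F \<longlongrightarrow> 0) (at q within {q. snd (snd q) \<le> t1})"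
        by (rule tendsto_eventually) (auto simp: eventually_at_filter F_def)
      ultimately have "(F \<longlongrightarrow> 0) (at q within strip t1 T \<union> {q. snd (snd q) \<le> t1})"
        by (simp add: Lim_within_Un)
      then have "(F \<longlongrightarrow> 0) (at q within B)"
        by (rule tendsto_within_subset) (auto simp: B_def strip_def T'_def)
      then show ?thesis by (simp add: continuous_within F_def qxy True)
    next
      case False
      have "continuous_on (strip t1 T) f"
        unfolding f_def H_def using t1
        by (intro continuous_on_divide continuous_on_subset[OF w_cont] continuous_on_barrier)
          (auto simp: strip_def barrier_pos[THEN less_imp_neq, symmetric])
      then have "continuous_on (strip t1 T) F"
        by (rule continuous_on_eq) (auto simp: F_def strip_def)
      moreover have "q \<in> strip t1 T" using s False by (auto simp: qxy strip_def T'_def)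
      ultimately have "(F \<longlongrightarrow> F q) (at q within strip t1 T)" by (simp add: continuous_on_def)
      moreover have "at q within B \<le> at q within strip t1 T"
      proof -
        have "open {q :: R3. t1 < snd (snd q)}" by (intro open_Collect_less continuous_intros)
        then have "at q within B = at q within (B \<inter> {q. t1 < snd (snd q)})"
          using s False by (intro at_within_nhd[where S = "{q. t1 < snd (snd q)}"]) (auto simp: qxy)
        also have "\<dots> \<le> at q within strip t1 T"
          by (intro at_le) (auto simp: B_def strip_def T'_def)
        finally show ?thesis .
      qed
      ultimately show ?thesis unfolding continuous_within using tendsto_mono by blast
    qed
  qed
  have inB: "(x, y, t) \<in> B" using R t by (auto simp: B_def T'_def)
  have "compact B" unfolding B_def by (intro compact_Times compact_Icc)
  from continuous_attains_sup[OF this _ F_cont] inB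
  obtain p where p: "p \<in> B" and Fp: "\<And>q. q \<in> B \<Longrightarrow> F q \<le> F p" by blast
  define m where "m = F p"
  have cm: "c \<le> m" using Fp[OF inB] t by (simp add: m_def F_def c_def)
  obtain X Y \<tau> where pX: "p = (X, Y, \<tau>)" by (cases p) auto
  \<comment> \<open>\<open>F\<close> is 0 at time \<open>t1\<close> while its maximum is at least
    \<open>c > 0\<close>, so the maximum is attained later.\<close>
  have \<tau>: "t1 < \<tau>" "\<tau> \<le> T" "\<tau> \<le> t1 + 1 / \<beta>"
    using p cm c unfolding m_def F_def by (auto simp: pX B_def T'_def split: if_splits)
  have m0: "0 < m" using cm c by simp
  have wp: "w p = m * H p" using \<tau> H_pos[of p] by (simp add: m_def F_def f_def pX)
  \<comment> \<open>In the box this is maximality, outside it \<open>f < c \<le> m\<close>. Times up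
    to \<tau> suffice, since the \<open>x\<close>-line through \<open>p\<close> stays at time \<tau>
    and the flow with positive parameter goes backward.\<close>
  have w_le: "w (x, y, s) \<le> m * H (x, y, s)" if "t1 < s" "s \<le> \<tau>" for x y s
  proof -
    have "f (x, y, s) \<le> m"
    proof (cases "(x, y, s) \<in> B")
      case True
      then show ?thesis using Fp[OF True] that by (simp add: m_def F_def)
    next
      case False
      then have "f (x, y, s) < c" using that \<tau> by (intro far) (auto simp: B_def T'_def)
      then show ?thesis using cm by simp
    qed
    then show ?thesis using H_pos by (simp add: f_def divide_le_eq)
  qed
  have pS: "p \<in> ?S" "\<And>\<xi>. (\<xi>, Y, \<tau>) \<in> ?S" using \<tau> t1 by (auto simp: pX strip_def)
  define k where "k = A + \<beta> * (\<tau> - t1)"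
  have k: "0 \<le> k" "k \<le> K"
  proof -
    show "0 \<le> k" using \<tau> \<beta> C by (simp add: k_def A_def)
    have "\<beta> * (\<tau> - t1) \<le> 1" using \<tau>(3) \<beta> by (simp add: field_simps)
    then show "k \<le> K" by (simp add: k_def A_def K_def)
  qed
  define wx where "wx = (\<lambda>q. dx u q - dx v q)"
  define wxx where "wxx = dx (dx u) p - dx (dx v) p"
  define wY where "wY = Y_deriv ?S u p - Y_deriv ?S v p"
  define h' where "h' = (\<lambda>\<xi>. wx (\<xi>, Y, \<tau>) - m * (H (\<xi>, Y, \<tau>) * (2 * k * \<xi>)))"
  have hd: "((\<lambda>\<xi>. w (\<xi>, Y, \<tau>) - m * H (\<xi>, Y, \<tau>)) has_real_derivative h' \<xi>) (at \<xi>)" for \<xi>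
    unfolding h'_def w_def wx_def H_def k_def using u v pS(2)
    by (intro DERIV_diff DERIV_cmult barrier_dx dx_has_real_derivative)
      (auto simp: classical_solution_def)
  have hdd: "(h' has_real_derivative wxx - m * (H p * (2 * k + 4 * k\<^sup>2 * X\<^sup>2))) (at X)"
    unfolding h'_def wx_def wxx_def H_def k_def pX using u v pS(2)
    by (intro DERIV_diff DERIV_cmult barrier_dxx dx_has_real_derivative)
      (auto simp: classical_solution_def)
  have hmax: "w (\<xi>, Y, \<tau>) - m * H (\<xi>, Y, \<tau>) \<le> w (X, Y, \<tau>) - m * H (X, Y, \<tau>)" for \<xi>
    using w_le[of \<tau> \<xi> Y] wp \<tau> by (simp add: pX)
  note second = real_maximum_second_derivative[OF hd hdd hmax]
  have wx_p: "wx p = m * (H p * (2 * k * X))" using second(1) by (simp add: h'_def pX)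
  have wxx_p: "wxx \<le> m * (H p * (2 * k + 4 * k\<^sup>2 * X\<^sup>2))" using second(2) by simp
  have wY_p: "wY \<le> m * (H p * (2 * k * X * Y - \<beta> * (X\<^sup>2 + Y\<^sup>2) - D))"
  proof -
    let ?I = "{0<..<\<tau> - t1}"
    have flow0: "Y_flow 0 p = p" by (simp add: Y_flow_def pX)
    have I: "Y_flow s p \<in> ?S" if "s \<in> ?I" for s using that \<tau> t1 by (auto simp: pX)
    have "((\<lambda>s. u (Y_flow s p)) has_real_derivative Y_deriv ?S u p) (at 0 within ?I)"
      "((\<lambda>s. v (Y_flow s p)) has_real_derivative Y_deriv ?S v p) (at 0 within ?I)"
      using has_Y_derivative_Y_deriv[OF pS(1)] u v pS(1) I
      by (intro has_Y_derivative_along_flow[where S = ?S]; simp add: flow0 classical_solution_def)+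
    then have "((\<lambda>s. w (Y_flow s p) - m * H (Y_flow s p)) has_real_derivative
        wY - m * (H p * (2 * k * X * Y - \<beta> * (X\<^sup>2 + Y\<^sup>2) - D))) (at 0 within ?I)"
      unfolding w_def wY_def H_def k_def pX
      by (intro DERIV_diff DERIV_cmult DERIV_subset[OF barrier_Y]) auto
    then have "((\<lambda>s. (w (Y_flow s p) - m * H (Y_flow s p)) / s) \<longlongrightarrow>
        wY - m * (H p * (2 * k * X * Y - \<beta> * (X\<^sup>2 + Y\<^sup>2) - D))) (at 0 within ?I)"
      using wp by (simp add: has_field_derivative_iff flow0)
    \<comment> \<open>The numerator vanishes at \<open>s = 0\<close> and is nonpositive along the
      backward flow. Using only \<open>s > 0\<close> covers the case \<open>\<tau> = T\<close> as
      well.\<close>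
    moreover have "\<forall>\<^sub>F s in at 0 within ?I. (w (Y_flow s p) - m * H (Y_flow s p)) / s \<le> 0"
      unfolding eventually_at_filter
      by (auto simp: pX Y_flow_def divide_le_0_iff w_le intro!: always_eventually)
    moreover have "at 0 within ?I \<noteq> bot" using \<tau> by (simp add: trivial_limit_within islimpt_greaterThanLessThan1)
    ultimately show ?thesis using tendsto_upperbound by fastforce
  qed
  have "0 = a p * wxx + (dx a p + b p) * wx p + wY - r p * w p"
  proof -
    have "K_op a b r ?S z p = 0 \<and> dx_exists (dx z) p" if "classical_solution a b r ?S z" for z
      using that pS(1) by (simp add: classical_solution_def)
    with u v have "a p * dx (dx u) p + (dx a p + b p) * dx u p + Y_deriv ?S u p - r p * u p = 0"
      "a p * dx (dx v) p + (dx a p + b p) * dx v p + Y_deriv ?S v p - r p * v p = 0"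
      using K_op_expand[OF da] by metis+
    then show ?thesis by (simp add: wxx_def wx_def wY_def w_def algebra_simps)
  qed
  \<comment> \<open>Nonnegativity of \<open>a\<close> preserves the second-order inequality; the
    first-order term is replaced by an equality, so the sign of its coefficient is
    irrelevant.\<close>
  also have "\<dots> \<le> a p * (m * (H p * (2 * k + 4 * k\<^sup>2 * X\<^sup>2))) + (dx a p + b p) * (m * (H p * (2 * k * X)))
      + m * (H p * (2 * k * X * Y - \<beta> * (X\<^sup>2 + Y\<^sup>2) - D)) - r p * (m * H p)"
    using mult_left_mono[OF wxx_p a0[of p]] wY_p by (simp add: wx_p wp)
  also have "\<dots> = m * H p * (a p * (2 * k + 4 * k\<^sup>2 * X\<^sup>2) + (dx a p + b p) * (2 * k * X)
      + (2 * k * X * Y - \<beta> * (X\<^sup>2 + Y\<^sup>2) - D) - r p)"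
    by (simp add: algebra_simps)
  also have "\<dots> < 0"
    using barrier_supersolution[OF k a0 aL a' b r] m0 H_pos[of p]
    by (intro mult_pos_neg) (auto simp: \<beta>_def D_def)
  finally show False by simp
qed

section \<open>Uniqueness on the whole strip\<close>

theorem theorem1p2:
  fixes a b r :: "real \<times> real \<times> real \<Rightarrow> real"
    and \<alpha> lam Lam t0 T M C :: real
    and \<phi> :: "real \<times> real \<Rightarrow> real"
    and u1 u2 :: "real \<times> real \<times> real \<Rightarrow> real"
  assumes "0 < \<alpha>" and "\<alpha> \<le> 1"
    and "\<And>p. dx_exists a p" and "\<And>p. dx_exists b p"
    and "holder_loc \<alpha> a" and "holder_loc \<alpha> b" and "holder_loc \<alpha> r"
    and "holder_loc \<alpha> (dx a)" and "holder_loc \<alpha> (dx b)"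
    and "0 < lam" and "0 < Lam"
    and "\<And>p. lam \<le> a p" and "\<And>p. a p \<le> Lam"
    and "\<And>p. \<bar>b p\<bar> \<le> Lam" and "\<And>p. \<bar>r p\<bar> \<le> Lam"
    and "\<And>p. \<bar>dx a p\<bar> \<le> Lam" and "\<And>p. \<bar>dx b p\<bar> \<le> Lam"
    and "t0 < T"
    and "cauchy_solution a b r t0 T \<phi> u1" and "cauchy_solution a b r t0 T \<phi> u2"
    and "0 < M" and "0 < C"
    and "\<And>x y t. (x, y, t) \<in> strip t0 T \<Longrightarrow>
           \<bar>u1 (x, y, t)\<bar> + \<bar>u2 (x, y, t)\<bar> \<le> M * exp (C * (x\<^sup>2 + y\<^sup>2))"
  shows "\<forall>p \<in> strip t0 T. u1 p = u2 p"
proof -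
  note a = \<open>\<And>p. dx_exists a p\<close>
  define \<beta> where "\<beta> = 4 * Lam * (C + 2)\<^sup>2 + 2 * Lam * (C + 2) + (C + 2)"
  have \<beta>: "0 < \<beta>" unfolding \<beta>_def using \<open>0 < Lam\<close> \<open>0 < C\<close> by (intro add_pos_pos) auto
  have sol: "classical_solution a b r (strip t0 T) u1" "classical_solution a b r (strip t0 T) u2"
    using assms unfolding cauchy_solution_def by blast+
  have a0: "0 \<le> a p" for p using \<open>0 < lam\<close> \<open>\<And>p. lam \<le> a p\<close>[of p] by simp
  have growth: "u1 (x, y, t) - u2 (x, y, t) \<le> M * exp (C * (x\<^sup>2 + y\<^sup>2))"
    "u2 (x, y, t) - u1 (x, y, t) \<le> M * exp (C * (x\<^sup>2 + y\<^sup>2))"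
    if "(x, y, t) \<in> strip t0 T" for x y t
    using assms(23)[OF that] by linarith+
  have step: "u1 (x, y, t) = u2 (x, y, t)"
    if t1: "t0 \<le> t1"
      and init: "\<And>x y. ((\<lambda>q. u1 q - u2 q) \<longlongrightarrow> 0) (at (x, y, t1) within strip t1 T)"
      and t: "t1 < t" "t \<le> T" "t \<le> t1 + 1 / \<beta>" for t1 x y t
  proof (rule antisym)
    have init': "((\<lambda>q. u2 q - u1 q) \<longlongrightarrow> 0) (at (x, y, t1) within strip t1 T)" for x y
      using tendsto_minus[OF init] by simp
    note comparison = cauchy_comparison_step[OF a a0 \<open>\<And>p. a p \<le> Lam\<close> \<open>\<And>p. \<bar>b p\<bar> \<le> Lam\<close>
        \<open>\<And>p. \<bar>r p\<bar> \<le> Lam\<close> \<open>\<And>p. \<bar>dx a p\<bar> \<le> Lam\<close> t1]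
    show "u1 (x, y, t) \<le> u2 (x, y, t)"
      by (rule comparison[OF sol \<open>0 < M\<close> \<open>0 < C\<close> growth(1) init t(1,2) t(3)[unfolded \<beta>_def]])
    show "u2 (x, y, t) \<le> u1 (x, y, t)"
      by (rule comparison[OF sol(2,1) \<open>0 < M\<close> \<open>0 < C\<close> growth(2) init' t(1,2) t(3)[unfolded \<beta>_def]])
  qed
  \<comment> \<open>Induction on the number of steps of length \<open>1 / \<beta>\<close>; for
    \<open>n = 0\<close> the time range is empty.\<close>
  have upto: "u1 (x, y, t) = u2 (x, y, t)"
    if "t0 < t" "t \<le> T" "t \<le> t0 + real n * (1 / \<beta>)" for n x y t
    using that
  proof (induction n arbitrary: x y t)
    case 0
    then show ?case by simp
  next
    case (Suc n)
    define t1 where "t1 = t0 + real n * (1 / \<beta>)"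
    show ?case
    proof (cases "t \<le> t1")
      case True
      then show ?thesis using Suc by (simp add: t1_def)
    next
      case False
      show ?thesis
      proof (rule step[of t1])
        show "t0 \<le> t1" using \<beta> by (simp add: t1_def)
        show "((\<lambda>q. u1 q - u2 q) \<longlongrightarrow> 0) (at (x, y, t1) within strip t1 T)" for x y
        \<comment> \<open>The first interval takes its zero initial limit from the common datum
          \<phi>. Later ones take it from equality at time \<open>t1\<close>, known by induction,
          and continuity of both solutions there.\<close>
        proof (cases "n = 0")
          case True
          then have "(u1 \<longlongrightarrow> \<phi> (x, y)) (at (x, y, t1) within strip t1 T)"
            "(u2 \<longlongrightarrow> \<phi> (x, y)) (at (x, y, t1) within strip t1 T)"
            using assms(19,20) by (auto simp: cauchy_solution_def t1_def)
          then show ?thesis using tendsto_diff by fastforce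
        next
          case n: False
          then have t1: "t0 < t1" "t1 \<le> T" using \<beta> False Suc.prems by (auto simp: t1_def)
          have "continuous_on (strip t0 T) (\<lambda>q. u1 q - u2 q)"
            using sol by (intro continuous_intros classical_solution_continuous_on)
          moreover have "u1 (x, y, t1) = u2 (x, y, t1)" using Suc.IH t1 by (simp add: t1_def)
          ultimately have "((\<lambda>q. u1 q - u2 q) \<longlongrightarrow> 0) (at (x, y, t1) within strip t0 T)"
            unfolding continuous_on_def using t1 by (drule_tac bspec[of _ _ "(x, y, t1)"]) (auto simp: strip_def)
          then show ?thesis
            by (rule tendsto_within_subset) (use t1 in \<open>auto simp: strip_def\<close>)
        qed
        show "t1 < t" "t \<le> T" "t \<le> t1 + 1 / \<beta>"
          using False Suc.prems by (auto simp: t1_def algebra_simps add_divide_distrib)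
      qed
    qed
  qed
  show ?thesis
  proof
    fix p assume p: "p \<in> strip t0 T"
    obtain x y t where pxy: "p = (x, y, t)" by (cases p) auto
    obtain n :: nat where "(t - t0) * \<beta> \<le> real n" using real_arch_simple by blast
    then have "t \<le> t0 + real n * (1 / \<beta>)" using \<beta> by (simp add: field_simps)
    then show "u1 p = u2 p" using upto p by (simp add: pxy strip_def)
  qed
qed

end
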